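(* Let $\mathcal{H}$ be a complex Hilbert space, let $T,S$ be $EP$ operators on $\mathcal{H}$ and let $A,B\in\mathcal{B}(\mathcal{H})$. If $AT=SB$ and $BT=SA$, then $AT^\dagger=S^\dagger B$ and $BT^\dagger=S^\dagger A$.
   Context: $\mathcal{B}(\mathcal{H})$ is the space of bounded linear operators on $\mathcal{H}$; $\mathcal{R}(T)$ denotes the range of $T$ and $T^*$ its adjoint. For $T\in\mathcal{B}(\mathcal{H})$ with closed range, the Moore-Penrose inverse $T^\dagger$ is the unique operator in $\mathcal{B}(\mathcal{H})$ satisfying $TT^\dagger T=T$, $T^\dagger TT^\dagger=T^\dagger$, $TT^\dagger=(TT^\dagger)^*$ and $T^\dagger T=(T^\dagger T)^*$. An $EP$ operator on $\mathcal{H}$ is a $T\in\mathcal{B}(\mathcal{H})$ with closed range such that $\mathcal{R}(T)=\mathcal{R}(T^* )$. *)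

theory Defs
  imports "HOL-Analysis.Analysis"
begin

class complex_vector = real_vector +
  fixes scaleC :: "complex \<Rightarrow> 'a \<Rightarrow> 'a"  (infixr "*\<^sub>C" 75)
  assumes scaleC_add_right: "a *\<^sub>C (x + y) = a *\<^sub>C x + a *\<^sub>C y"
    and scaleC_add_left: "(a + b) *\<^sub>C x = a *\<^sub>C x + b *\<^sub>C x"
    and scaleC_scaleC: "a *\<^sub>C b *\<^sub>C x = (a * b) *\<^sub>C x"
    and scaleC_one: "1 *\<^sub>C x = x"
    and scaleR_scaleC: "r *\<^sub>R x = complex_of_real r *\<^sub>C x"

text \<open>The inner product is linear in the first argument. The norm, and with it the metric and the
  topology, is the one induced by the inner product.\<close>

class complex_inner = complex_vector + real_normed_vector +
  fixes cinner :: "'a \<Rightarrow> 'a \<Rightarrow> complex"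
  assumes cinner_commute: "cinner x y = cnj (cinner y x)"
    and cinner_add_left: "cinner (x + y) z = cinner x z + cinner y z"
    and cinner_scaleC_left: "cinner (a *\<^sub>C x) y = a * cinner x y"
    and cinner_ge_zero: "0 \<le> Re (cinner x x)"
    and cinner_eq_zero_iff: "cinner x x = 0 \<longleftrightarrow> x = 0"
    and norm_eq_sqrt_cinner: "norm x = sqrt (Re (cinner x x))"

class chilbert_space = complex_inner + complete_space

instantiation complex :: chilbert_space
begin

definition scaleC_complex :: "complex \<Rightarrow> complex \<Rightarrow> complex"
  where "scaleC_complex a x = a * x"

definition cinner_complex :: "complex \<Rightarrow> complex \<Rightarrow> complex"
  where "cinner_complex x y = x * cnj y"

instance
  by standard
    (auto simp: scaleC_complex_def cinner_complex_def algebra_simps scaleR_conv_of_real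
      cmod_def power2_eq_square)

end

definition bounded_clinear :: "('a::complex_inner \<Rightarrow> 'b::complex_inner) \<Rightarrow> bool"
  where "bounded_clinear T \<longleftrightarrow> bounded_linear T \<and> (\<forall>c x. T (c *\<^sub>C x) = c *\<^sub>C T x)"

text \<open>The two definite descriptions below denote the intended operators for bounded operators
  (by the Riesz representation theorem) and for bounded operators with closed range,
  respectively; for other arguments they are unspecified.\<close>

definition cadjoint :: "('a::chilbert_space \<Rightarrow> 'a) \<Rightarrow> 'a \<Rightarrow> 'a"
  where "cadjoint T =
    (THE U. bounded_clinear U \<and> (\<forall>x y. cinner (T x) y = cinner x (U y)))"

definition mp_inverse :: "('a::chilbert_space \<Rightarrow> 'a) \<Rightarrow> 'a \<Rightarrow> 'a"
  where "mp_inverse T =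
    (THE X. bounded_clinear X \<and>
       T \<circ> X \<circ> T = T \<and> X \<circ> T \<circ> X = X \<and>
       T \<circ> X = cadjoint (T \<circ> X) \<and> X \<circ> T = cadjoint (X \<circ> T))"

definition EP_operator :: "('a::chilbert_space \<Rightarrow> 'a) \<Rightarrow> bool"
  where "EP_operator T \<longleftrightarrow>
    bounded_clinear T \<and> closed (range T) \<and> range T = range (cadjoint T)"

end

theory Submission
  imports Defs
begin

text \<open>
  The Moore-Penrose inverse \<open>X\<close> of an \<open>EP\<close> operator \<open>T\<close> commutes with \<open>T\<close>, because \<open>T X\<close> and
  \<open>X T\<close> are the orthogonal projections onto the ranges of \<open>T\<close> and of \<open>T\<^sup>*\<close>, which coincide.
  With \<open>Y\<close> the inverse of \<open>S\<close>, commutation gives \<open>X = T X X = X X T\<close> and \<open>Y = Y Y S = S Y Y\<close>, and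
  then the hypotheses \<open>A T = S B\<close> and \<open>B T = S A\<close> alone bring both \<open>A X\<close> and \<open>Y B\<close> to the common
  value \<open>Y B T X\<close> (lemma \<open>intertwine_group_inverse\<close>). Exchanging \<open>A\<close> and \<open>B\<close> yields the other
  equation.

  The analytic work is to show that the adjoint and the Moore-Penrose inverse really exist, so that
  the definite descriptions defining them can be used. The adjoint comes from the Riesz
  representation theorem, hence from orthogonal projection onto closed subspaces. For an \<open>EP\<close>
  operator \<open>T\<close> the space is the orthogonal sum of the range \<open>M\<close> and the kernel of \<open>T\<close>, so \<open>T\<close>
  restricts to a bijection of \<open>M\<close>, and \<open>X\<close> is the inverse of that restriction preceded by the
  projection onto \<open>M\<close>. To see that \<open>X\<close> is bounded, note that every vector of \<open>M\<close> has the form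
  \<open>T\<^sup>* z\<close>. The identity \<open>\<langle>x, T\<^sup>* z\<rangle> = \<langle>T x, z\<rangle>\<close> then shows that the vectors \<open>x \<in> M\<close> with
  \<open>\<parallel>T x\<parallel> \<le> 1\<close> form a weakly bounded set, which is bounded in norm by the uniform boundedness
  principle.
\<close>

section \<open>Complex inner products\<close>

lemma cinner_add_right: "cinner x (y + z) = cinner x y + cinner x z"
  by (metis cinner_add_left cinner_commute complex_cnj_add)

lemma cinner_scaleC_right: "cinner x (a *\<^sub>C y) = cnj a * cinner x y"
  by (metis cinner_scaleC_left cinner_commute complex_cnj_mult)

lemma scaleC_minus_one: "(-1) *\<^sub>C x = - x"
  using scaleR_scaleC[of "-1" x] by simp

lemma cinner_minus_left: "cinner (- x) y = - cinner x y"
  by (metis cinner_scaleC_left scaleC_minus_one mult_minus1)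

lemma cinner_minus_right: "cinner x (- y) = - cinner x y"
  by (metis cinner_minus_left cinner_commute complex_cnj_minus)

lemma cinner_diff_left: "cinner (x - y) z = cinner x z - cinner y z"
  using cinner_add_left[of x "- y" z] by (simp add: cinner_minus_left)

lemma cinner_diff_right: "cinner x (y - z) = cinner x y - cinner x z"
  using cinner_add_right[of x y "- z"] by (simp add: cinner_minus_right)

lemma cinner_zero_left [simp]: "cinner 0 y = 0"
  using cinner_diff_left[of 0 0 y] by simp

lemma cinner_zero_right [simp]: "cinner x 0 = 0"
  using cinner_diff_right[of x 0 0] by simp

lemma cinner_scaleR_left: "cinner (r *\<^sub>R x) y = of_real r * cinner x y"
  by (simp add: scaleR_scaleC cinner_scaleC_left)

lemma cinner_scaleR_right: "cinner x (r *\<^sub>R y) = of_real r * cinner x y"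
  by (simp add: scaleR_scaleC cinner_scaleC_right)

lemma cinner_self: "cinner x x = of_real ((norm x)\<^sup>2)"
proof -
  have "Im (cinner x x) = 0"
    using arg_cong[OF cinner_commute[of x x], of Im] by simp
  then show ?thesis
    by (simp add: complex_eq_iff norm_eq_sqrt_cinner cinner_ge_zero)
qed

lemma cinner_ext:
  assumes "\<And>x. cinner x y = cinner x z"
  shows "y = z"
proof -
  have "cinner (y - z) (y - z) = 0"
    using assms by (simp add: cinner_diff_right)
  then show ?thesis
    by (simp add: cinner_eq_zero_iff)
qed

lemma norm_add_eq_if_orthogonal:
  assumes "cinner x y = 0"
  shows "(norm (x + y))\<^sup>2 = (norm x)\<^sup>2 + (norm y)\<^sup>2"
proof -
  have "cinner y x = 0"
    using assms cinner_commute[of y x] by simp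
  then have "cinner (x + y) (x + y) = cinner x x + cinner y y"
    using assms by (simp add: cinner_add_left cinner_add_right)
  then show ?thesis
    unfolding cinner_self by (simp only: of_real_add [symmetric] of_real_eq_iff)
qed

lemma parallelogram_law:
  "(norm (x + y))\<^sup>2 + (norm (x - y))\<^sup>2 = 2 * (norm x)\<^sup>2 + 2 * (norm y)\<^sup>2"
  for x y :: "'a::complex_inner"
proof -
  have "cinner (x + y) (x + y) + cinner (x - y) (x - y) = 2 * cinner x x + 2 * cinner y y"
    by (simp add: cinner_add_left cinner_add_right cinner_diff_left cinner_diff_right)
  then have "of_real ((norm (x + y))\<^sup>2 + (norm (x - y))\<^sup>2)
      = (of_real (2 * (norm x)\<^sup>2 + 2 * (norm y)\<^sup>2) :: complex)"
    unfolding cinner_self by simp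
  then show ?thesis
    by (simp only: of_real_eq_iff)
qed

text \<open>Subtracting from \<open>x\<close> its component along \<open>y\<close> shortens \<open>x\<close> by a definite amount. As a norm
  is nonnegative this implies the Cauchy-Schwarz inequality; and a vector of minimal length in its
  coset modulo a subspace has no component along that subspace.\<close>

lemma norm_diff_component:
  assumes "y \<noteq> 0"
  shows "(norm (x - (cinner x y / cinner y y) *\<^sub>C y))\<^sup>2 = (norm x)\<^sup>2 - (cmod (cinner x y))\<^sup>2 / (norm y)\<^sup>2"
proof -
  define c where "c = cinner x y / cinner y y"
  have nz: "cinner y y \<noteq> 0"
    using assms by (simp add: cinner_eq_zero_iff)
  have "cinner (x - c *\<^sub>C y) (c *\<^sub>C y) = 0"
    using nz by (simp add: cinner_diff_left cinner_scaleC_left cinner_scaleC_right c_def)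
  from norm_add_eq_if_orthogonal[OF this]
  have "(norm x)\<^sup>2 = (norm (x - c *\<^sub>C y))\<^sup>2 + (norm (c *\<^sub>C y))\<^sup>2"
    by simp
  moreover have "(norm (c *\<^sub>C y))\<^sup>2 = (cmod (cinner x y))\<^sup>2 / (norm y)\<^sup>2"
  proof -
    have "of_real ((norm (c *\<^sub>C y))\<^sup>2) = c * cnj c * cinner y y"
      by (simp only: cinner_self [symmetric] cinner_scaleC_left cinner_scaleC_right mult_ac)
    also have "\<dots> = of_real ((cmod c)\<^sup>2 * (norm y)\<^sup>2)"
      by (simp only: cinner_self of_real_mult complex_norm_square)
    finally have "(norm (c *\<^sub>C y))\<^sup>2 = (cmod c)\<^sup>2 * (norm y)\<^sup>2"
      by (simp only: of_real_eq_iff)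
    moreover have "cmod c = cmod (cinner x y) / (norm y)\<^sup>2"
      by (simp add: c_def cinner_self norm_divide norm_power)
    ultimately show ?thesis
      using assms by (simp add: field_simps power2_eq_square)
  qed
  ultimately show ?thesis
    by (simp add: c_def)
qed

lemma cinner_Cauchy_Schwarz: "cmod (cinner x y) \<le> norm x * norm y"
proof (cases "y = 0")
  case False
  have "(cmod (cinner x y))\<^sup>2 / (norm y)\<^sup>2 \<le> (norm x)\<^sup>2"
    using norm_diff_component[OF False, of x] by (metis diff_ge_0_iff_ge zero_le_power2)
  then have "(cmod (cinner x y))\<^sup>2 \<le> (norm x * norm y)\<^sup>2"
    using False by (simp add: field_simps)
  then show ?thesis
    by (rule power2_le_imp_le) simp
qed simp

lemma bounded_linear_cinner_left: "bounded_linear (\<lambda>x. cinner x y)"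
  by (rule bounded_linear_intro[where K = "norm y"])
    (simp_all add: cinner_add_left cinner_scaleR_left cinner_Cauchy_Schwarz scaleR_conv_of_real)

lemma bounded_linear_cinner_right: "bounded_linear (\<lambda>y. cinner x y)"
  by (rule bounded_linear_intro[where K = "norm x"])
    (simp_all add: cinner_add_right cinner_scaleR_right scaleR_conv_of_real
      cinner_Cauchy_Schwarz mult.commute[of "norm _" "norm x"])

section \<open>Bounded complex-linear maps\<close>

lemma bounded_clinear_imp_bounded_linear: "bounded_clinear T \<Longrightarrow> bounded_linear T"
  by (simp add: bounded_clinear_def)

lemma bounded_clinear_scaleC: "bounded_clinear T \<Longrightarrow> T (c *\<^sub>C x) = c *\<^sub>C T x"
  by (simp add: bounded_clinear_def)

lemmas bounded_clinear_linear = bounded_linear.linear[OF bounded_clinear_imp_bounded_linear]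
lemmas bounded_clinear_add = linear_add[OF bounded_clinear_linear]
lemmas bounded_clinear_diff = linear_diff[OF bounded_clinear_linear]

lemma bounded_clinearI:
  assumes "\<And>x y. T (x + y) = T x + T y" and "\<And>c x. T (c *\<^sub>C x) = c *\<^sub>C T x"
    and "\<And>x. norm (T x) \<le> norm x * K"
  shows "bounded_clinear T"
  unfolding bounded_clinear_def
  by (intro conjI bounded_linear_intro[where K = K]) (simp_all add: assms scaleR_scaleC)

lemma bounded_clinear_compose:
  assumes "bounded_clinear S" and "bounded_clinear T"
  shows "bounded_clinear (S \<circ> T)"
  using assms bounded_linear_compose[of S T] by (simp add: bounded_clinear_def comp_def)

section \<open>Orthogonal projection and the Riesz representation theorem\<close>

definition csubspace :: "'a::complex_vector set \<Rightarrow> bool"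
  where "csubspace M \<longleftrightarrow>
    0 \<in> M \<and> (\<forall>x\<in>M. \<forall>y\<in>M. x + y \<in> M) \<and> (\<forall>c. \<forall>x\<in>M. c *\<^sub>C x \<in> M)"

lemma csubspace_add: "csubspace M \<Longrightarrow> x \<in> M \<Longrightarrow> y \<in> M \<Longrightarrow> x + y \<in> M"
  by (simp add: csubspace_def)

lemma csubspace_scaleC: "csubspace M \<Longrightarrow> x \<in> M \<Longrightarrow> c *\<^sub>C x \<in> M"
  by (simp add: csubspace_def)

lemma csubspace_diff:
  assumes "csubspace M" and "x \<in> M" and "y \<in> M"
  shows "x - y \<in> M"
  using assms unfolding csubspace_def by (metis scaleC_minus_one diff_conv_add_uminus)

text \<open>A sequence in \<open>M\<close> whose squared distances from \<open>x\<close> tend to their infimum \<open>D\<close> is Cauchy: the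
  midpoint of two of its members lies in \<open>M\<close>, so by the parallelogram law two almost optimal members
  are close to each other. Its limit \<open>p\<close> is a point of \<open>M\<close> nearest to \<open>x\<close>, and then \<open>x - p\<close> cannot be
  shortened by subtracting a component along \<open>M\<close>.\<close>

lemma orthogonal_projection_exists:
  fixes M :: "'a::chilbert_space set"
  assumes sub: "csubspace M" and "closed M"
  shows "\<exists>p\<in>M. \<forall>m\<in>M. cinner (x - p) m = 0"
proof -
  define D where "D = (INF m\<in>M. (norm (x - m))\<^sup>2)"
  have bdd: "bdd_below ((\<lambda>m. (norm (x - m))\<^sup>2) ` M)"
    by (rule bdd_belowI[where m = 0]) auto
  have D_le: "D \<le> (norm (x - m))\<^sup>2" if "m \<in> M" for m
    unfolding D_def using bdd that by (rule cINF_lower)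
  have "\<exists>m\<in>M. (norm (x - m))\<^sup>2 < D + 1 / Suc n" for n
  proof -
    have "M \<noteq> {}"
      using sub by (auto simp: csubspace_def)
    moreover have "D < D + 1 / Suc n"
      by simp
    ultimately show ?thesis
      unfolding D_def using bdd by (subst (asm) cINF_less_iff) auto
  qed
  then obtain f where fM: "\<And>n. f n \<in> M" and f_less: "\<And>n. (norm (x - f n))\<^sup>2 < D + 1 / Suc n"
    by metis
  have close: "(norm (f i - f j))\<^sup>2 \<le> 2 / Suc i + 2 / Suc j" for i j
  proof -
    have "(1/2) *\<^sub>C (f i + f j) \<in> M"
      using sub fM by (simp add: csubspace_def)
    then have "(1/2) *\<^sub>R (f i + f j) \<in> M"
      by (simp add: scaleR_scaleC)
    then have "D \<le> (norm (x - (1/2) *\<^sub>R (f i + f j)))\<^sup>2"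
      by (rule D_le)
    moreover have "(x - f i) + (x - f j) = 2 *\<^sub>R (x - (1/2) *\<^sub>R (f i + f j))"
      by (simp add: algebra_simps scaleR_2)
    then have "(norm ((x - f i) + (x - f j)))\<^sup>2 = 4 * (norm (x - (1/2) *\<^sub>R (f i + f j)))\<^sup>2"
      by (simp add: power_mult_distrib)
    moreover have "norm ((x - f i) - (x - f j)) = norm (f i - f j)"
      by (simp add: norm_minus_commute)
    ultimately show ?thesis
      using parallelogram_law[of "x - f i" "x - f j"] f_less[of i] f_less[of j] by simp
  qed
  have "Cauchy f"
  proof (rule metric_CauchyI)
    fix e :: real
    assume "0 < e"
    then obtain N where N: "4 / e\<^sup>2 < real N"
      using reals_Archimedean2 by blast
    have "dist (f i) (f j) < e" if "i \<ge> N" "j \<ge> N" for i j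
    proof -
      have "0 < real N"
        using N \<open>0 < e\<close> by (smt (verit) divide_nonneg_nonneg zero_le_power2)
      then have "2 / Suc i \<le> 2 / real N" "2 / Suc j \<le> 2 / real N"
        using that by (auto intro!: divide_left_mono)
      then have "(norm (f i - f j))\<^sup>2 \<le> 4 / real N"
        using close[of i j] by simp
      also have "\<dots> < e\<^sup>2"
        using N \<open>0 < e\<close> \<open>0 < real N\<close> by (simp add: field_simps)
      finally show ?thesis
        using \<open>0 < e\<close> by (simp add: dist_norm power2_less_imp_less)
    qed
    then show "\<exists>N. \<forall>i\<ge>N. \<forall>j\<ge>N. dist (f i) (f j) < e"
      by blast
  qed
  then obtain p where p: "f \<longlonglongrightarrow> p"
    using Cauchy_convergent convergent_def by blast
  have "p \<in> M"
    using \<open>closed M\<close> fM p closed_sequential_limits by blast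
  have "(\<lambda>n. (norm (x - f n))\<^sup>2) \<longlonglongrightarrow> (norm (x - p))\<^sup>2"
    by (intro tendsto_intros p)
  moreover have "(\<lambda>n. D + 1 / Suc n) \<longlonglongrightarrow> D"
    using tendsto_add[OF tendsto_const[of D] LIMSEQ_inverse_real_of_nat]
    by (simp add: inverse_eq_divide)
  ultimately have p_le: "(norm (x - p))\<^sup>2 \<le> D"
    by (rule LIMSEQ_le) (use f_less less_imp_le in blast)
  have "cinner (x - p) m = 0" if "m \<in> M" for m
  proof (cases "m = 0")
    case False
    define c where "c = cinner (x - p) m / cinner m m"
    have "p + c *\<^sub>C m \<in> M"
      using sub \<open>p \<in> M\<close> that by (simp add: csubspace_def)
    then have "(norm (x - p))\<^sup>2 \<le> (norm (x - p - c *\<^sub>C m))\<^sup>2"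
      using D_le p_le by (metis diff_diff_eq order_trans)
    then have "(cmod (cinner (x - p) m))\<^sup>2 / (norm m)\<^sup>2 \<le> 0"
      unfolding c_def norm_diff_component[OF False] by simp
    then show ?thesis
      using False by (simp add: field_simps)
  qed simp
  then show ?thesis
    using \<open>p \<in> M\<close> by blast
qed

text \<open>A nonzero vector \<open>z\<close> orthogonal to the kernel of \<open>f\<close> represents \<open>f\<close> up to a scalar, because
  \<open>f z *\<^sub>C x - f x *\<^sub>C z\<close> lies in that kernel for every \<open>x\<close>.\<close>

lemma Riesz_representation:
  fixes f :: "'a::chilbert_space \<Rightarrow> complex"
  assumes f: "bounded_clinear f"
  obtains u where "\<And>x. f x = cinner x u"
proof (cases "\<forall>x. f x = 0")
  case True
  then show thesis
    using that[of 0] by simp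
next
  case False
  then obtain x0 where x0: "f x0 \<noteq> 0"
    by blast
  define M where "M = {x. f x = 0}"
  have fC: "f (c *\<^sub>C x) = c * f x" for c x
    using bounded_clinear_scaleC[OF f] by (simp add: scaleC_complex_def)
  have "csubspace M"
    unfolding csubspace_def M_def
    using bounded_clinear_add[OF f] linear_0[OF bounded_clinear_linear[OF f]] fC by simp
  moreover have "closed M"
    unfolding M_def
    using linear_continuous_on[OF bounded_clinear_imp_bounded_linear[OF f]]
    by (intro closed_Collect_eq continuous_on_const)
  ultimately obtain p where "p \<in> M" and orth: "\<And>m. m \<in> M \<Longrightarrow> cinner (x0 - p) m = 0"
    using orthogonal_projection_exists[of M x0] by blast
  define z where "z = x0 - p"
  have fz: "f z \<noteq> 0"
    using x0 \<open>p \<in> M\<close> by (simp add: z_def M_def bounded_clinear_diff[OF f])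
  then have "z \<noteq> 0"
    using linear_0[OF bounded_clinear_linear[OF f]] by auto
  then have zz: "cinner z z \<noteq> 0"
    by (simp add: cinner_eq_zero_iff)
  have "f x = cinner x (cnj (f z / cinner z z) *\<^sub>C z)" for x
  proof -
    have "f z *\<^sub>C x - f x *\<^sub>C z \<in> M"
      by (simp add: M_def bounded_clinear_diff[OF f] fC)
    then have "cinner z (f z *\<^sub>C x - f x *\<^sub>C z) = 0"
      using orth by (simp add: z_def)
    then have "cinner (f z *\<^sub>C x - f x *\<^sub>C z) z = 0"
      using cinner_commute[of "f z *\<^sub>C x - f x *\<^sub>C z" z] by simp
    then show ?thesis
      using zz by (simp add: cinner_diff_left cinner_scaleC_left cinner_scaleC_right field_simps)
  qed
  then show thesis
    using that by blast
qed

section \<open>Adjoints\<close>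

lemma cadjoint_eqI:
  assumes "bounded_clinear U" and "\<And>x y. cinner (T x) y = cinner x (U y)"
  shows "cadjoint T = U"
  unfolding cadjoint_def
proof (rule the_equality)
  fix V
  assume "bounded_clinear V \<and> (\<forall>x y. cinner (T x) y = cinner x (V y))"
  then have "cinner x (V y) = cinner x (U y)" for x y
    using assms(2) by simp
  then show "V = U"
    by (intro ext) (rule cinner_ext)
qed (simp add: assms)

text \<open>The representing vectors of the functionals \<open>x \<mapsto> \<langle>T x, y\<rangle>\<close> define the adjoint. It is bounded
  because \<open>\<parallel>U y\<parallel>\<^sup>2 = \<langle>T (U y), y\<rangle>\<close>.\<close>

lemma cadjoint_exists:
  fixes T :: "'a::chilbert_space \<Rightarrow> 'a"
  assumes T: "bounded_clinear T"
  obtains U where "bounded_clinear U" and "\<And>x y. cinner (T x) y = cinner x (U y)"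
proof -
  have "\<exists>u. \<forall>x. cinner (T x) y = cinner x u" for y
  proof -
    have "bounded_clinear (\<lambda>x. cinner (T x) y)"
      unfolding bounded_clinear_def
      using bounded_linear_compose[OF bounded_linear_cinner_left
          bounded_clinear_imp_bounded_linear[OF T]]
      by (simp add: bounded_clinear_scaleC[OF T] cinner_scaleC_left scaleC_complex_def)
    from Riesz_representation[OF this] show ?thesis
      by blast
  qed
  then have "\<exists>U. \<forall>y x. cinner (T x) y = cinner x (U y)"
    by (intro choice) blast
  then obtain U where U: "\<And>x y. cinner (T x) y = cinner x (U y)"
    by blast
  obtain K where K: "\<And>x. norm (T x) \<le> norm x * K"
    using bounded_linear.bounded[OF bounded_clinear_imp_bounded_linear[OF T]] by blast
  have "bounded_clinear U"
  proof (rule bounded_clinearI)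
    show "U (y + z) = U y + U z" for y z
      by (rule cinner_ext) (simp add: U [symmetric] cinner_add_right)
    show "U (c *\<^sub>C y) = c *\<^sub>C U y" for c y
      by (rule cinner_ext) (simp add: U [symmetric] cinner_scaleC_right)
    show "norm (U y) \<le> norm y * K" for y
    proof (cases "U y = 0")
      case True
      have "0 \<le> norm y * K"
        by (rule order_trans[OF norm_ge_zero K])
      then show ?thesis
        using True by simp
    next
      case False
      have "norm (U y) * norm (U y) = cmod (cinner (T (U y)) y)"
        by (simp add: U cinner_self norm_power power2_eq_square norm_mult)
      also have "\<dots> \<le> norm (T (U y)) * norm y"
        by (rule cinner_Cauchy_Schwarz)
      also have "\<dots> \<le> norm (U y) * K * norm y"
        using K by (intro mult_right_mono) auto
      finally show ?thesis
        using False by (simp add: mult_ac)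
    qed
  qed
  then show thesis
    using that U by blast
qed

lemma cinner_cadjoint:
  fixes T :: "'a::chilbert_space \<Rightarrow> 'a"
  assumes "bounded_clinear T"
  shows "cinner (T x) y = cinner x (cadjoint T y)"
proof -
  obtain U where "bounded_clinear U" and U: "\<And>x y. cinner (T x) y = cinner x (U y)"
    using cadjoint_exists[OF assms] by blast
  then have "cadjoint T = U"
    by (rule cadjoint_eqI)
  then show ?thesis
    using U by simp
qed

section \<open>The uniform boundedness principle\<close>

text \<open>If a set is weakly bounded, then the closed sets of vectors against which it is bounded by
  \<open>n\<close> exhaust the space, so by Baire one of them contains a ball. Testing each member \<open>x\<close> of the set
  against the centre of the ball and its translate by a multiple of \<open>x\<close> bounds the norm of \<open>x\<close>.\<close>

lemma weakly_bounded_imp_bounded: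
  fixes F :: "'a::chilbert_space set"
  assumes weak: "\<And>y. \<exists>K. \<forall>x\<in>F. cmod (cinner x y) \<le> K"
  shows "\<exists>K. \<forall>x\<in>F. norm x \<le> K"
proof -
  define C where "C n = {y. \<forall>x\<in>F. cmod (cinner x y) \<le> real n}" for n
  have "closed (C n)" for n
  proof -
    have "C n = (\<Inter>x\<in>F. {y. cmod (cinner x y) \<le> real n})"
      by (auto simp: C_def)
    moreover have "closed {y. cmod (cinner x y) \<le> real n}" for x :: 'a
      by (intro closed_Collect_le continuous_on_norm continuous_on_const linear_continuous_on[OF
          bounded_linear_cinner_right])
    ultimately show ?thesis
      by auto
  qed
  moreover have "y \<in> (\<Union>n. C n)" for y
  proof -
    obtain K where K: "\<forall>x\<in>F. cmod (cinner x y) \<le> K"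
      using weak by blast
    obtain n where "K \<le> real n"
      using real_arch_simple by blast
    then have "y \<in> C n"
      using K by (auto simp: C_def intro: order_trans)
    then show ?thesis
      by blast
  qed
  then have "(\<Union>n. C n) = UNIV"
    by blast
  moreover have "Met_TC.mcomplete TYPE('a)"
    by (simp add: complete_UNIV)
  ultimately obtain n where "interior (C n) \<noteq> {}"
    using Met_TC.metric_Baire_category_alt[of "range C"] by auto
  then obtain y0 where "y0 \<in> interior (C n)"
    by blast
  then obtain r where "r > 0" and r: "cball y0 r \<subseteq> C n"
    by (auto simp: mem_interior_cball)
  have "norm x \<le> 2 * real n / r" if "x \<in> F" for x
  proof (cases "x = 0")
    case False
    define u where "u = (r / norm x) *\<^sub>R x"
    have "norm u = r"
      using False \<open>r > 0\<close> by (simp add: u_def)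
    then have "y0 \<in> C n" "y0 + u \<in> C n"
      using r \<open>r > 0\<close> by (auto simp: subset_iff dist_norm)
    then have "cmod (cinner x y0) \<le> n" "cmod (cinner x (y0 + u)) \<le> n"
      using that by (auto simp: C_def)
    moreover have "cinner x u = cinner x (y0 + u) - cinner x y0"
      by (simp add: cinner_add_right)
    ultimately have "cmod (cinner x u) \<le> 2 * real n"
      using norm_triangle_ineq4[of "cinner x (y0 + u)" "cinner x y0"] by simp
    moreover have "cmod (cinner x u) = r * norm x"
      using False \<open>r > 0\<close>
      by (simp add: u_def cinner_scaleR_right cinner_self norm_mult norm_divide norm_power
          power2_eq_square)
    ultimately show ?thesis
      using \<open>r > 0\<close> by (simp add: field_simps)
  qed (use \<open>r > 0\<close> in simp)
  then show ?thesis
    by blast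
qed

section \<open>The Moore-Penrose inverse of an EP operator\<close>

text \<open>Two Moore-Penrose inverses \<open>X\<close> and \<open>Y\<close> of \<open>T\<close> satisfy \<open>T X = T Y T X\<close> and \<open>T Y = T X T Y\<close>;
  taking adjoints turns the first product into the second, so \<open>T X = T Y\<close>. In the same way
  \<open>X T = Y T\<close>, and then \<open>X = X T X = X T Y = Y T Y = Y\<close>.\<close>

lemma mp_inverse_eqI:
  fixes T X :: "'a::chilbert_space \<Rightarrow> 'a"
  assumes T: "bounded_clinear T" and X: "bounded_clinear X"
    and TXT: "T \<circ> X \<circ> T = T" and XTX: "X \<circ> T \<circ> X = X"
    and TX: "T \<circ> X = cadjoint (T \<circ> X)" and XT: "X \<circ> T = cadjoint (X \<circ> T)"
  shows "mp_inverse T = X"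
  unfolding mp_inverse_def
proof (rule the_equality)
  fix Y
  assume "bounded_clinear Y \<and> T \<circ> Y \<circ> T = T \<and> Y \<circ> T \<circ> Y = Y \<and>
    T \<circ> Y = cadjoint (T \<circ> Y) \<and> Y \<circ> T = cadjoint (Y \<circ> T)"
  then have Y: "bounded_clinear Y" and TYT: "T \<circ> Y \<circ> T = T" and YTY: "Y \<circ> T \<circ> Y = Y"
    and TY: "T \<circ> Y = cadjoint (T \<circ> Y)" and YT: "Y \<circ> T = cadjoint (Y \<circ> T)"
    by blast+
  note pw = TXT[THEN fun_cong, simplified] XTX[THEN fun_cong, simplified]
    TYT[THEN fun_cong, simplified] YTY[THEN fun_cong, simplified]
  have sa: "cinner (T (X a)) b = cinner a (T (X b))" "cinner (T (Y a)) b = cinner a (T (Y b))"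
    "cinner (X (T a)) b = cinner a (X (T b))" "cinner (Y (T a)) b = cinner a (Y (T b))" for a b
    using cinner_cadjoint[OF bounded_clinear_compose[OF T X], of a b]
      cinner_cadjoint[OF bounded_clinear_compose[OF T Y], of a b]
      cinner_cadjoint[OF bounded_clinear_compose[OF X T], of a b]
      cinner_cadjoint[OF bounded_clinear_compose[OF Y T], of a b]
    by (simp_all flip: TX XT TY YT)
  have "cinner a (T (X b)) = cinner a (T (Y b))" for a b
  proof -
    have "cinner a (T (X b)) = cinner (T (Y (T (X a)))) b"
      by (simp add: pw sa)
    also have "\<dots> = cinner a (T (X (T (Y b))))"
      by (simp only: sa)
    finally show ?thesis
      by (simp add: pw)
  qed
  then have 1: "T (X b) = T (Y b)" for b
    by (rule cinner_ext)
  have "cinner a (X (T b)) = cinner a (Y (T b))" for a b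
  proof -
    have "cinner a (X (T b)) = cinner (X (T (Y (T a)))) b"
      by (simp add: pw sa)
    also have "\<dots> = cinner a (Y (T (X (T b))))"
      by (simp only: sa)
    finally show ?thesis
      by (simp add: pw)
  qed
  then have 2: "X (T b) = Y (T b)" for b
    by (rule cinner_ext)
  show "Y = X"
    using 1 2 pw by (intro ext) metis
qed (intro conjI assms)

lemma range_csubspace:
  assumes "bounded_clinear T"
  shows "csubspace (range T)"
  unfolding csubspace_def
  using linear_0[OF bounded_clinear_linear[OF assms]] bounded_clinear_add[OF assms]
    bounded_clinear_scaleC[OF assms]
  by (auto simp: image_iff) metis+

text \<open>The kernel of any bounded operator is the orthogonal complement of the range of its adjoint,
  here equal to the range of the operator itself.\<close>

lemma EP_operator_kernel:
  fixes T :: "'a::chilbert_space \<Rightarrow> 'a"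
  assumes "EP_operator T"
  shows "T x = 0 \<longleftrightarrow> (\<forall>m\<in>range T. cinner x m = 0)"
proof -
  have T: "bounded_clinear T" and r: "range T = range (cadjoint T)"
    using assms by (auto simp: EP_operator_def)
  have "(\<forall>m\<in>range T. cinner x m = 0) \<longleftrightarrow> (\<forall>y. cinner (T x) y = 0)"
    unfolding r by (simp add: cinner_cadjoint[OF T])
  also have "\<dots> \<longleftrightarrow> T x = 0"
    by (metis cinner_eq_zero_iff cinner_zero_left)
  finally show ?thesis
    by simp
qed

text \<open>The lower bound on the range follows from weak boundedness of its vectors \<open>x\<close> with
  \<open>\<parallel>T x\<parallel> \<le> 1\<close>. Against a vector \<open>y\<close> such an \<open>x\<close> has the same inner product as against the
  projection \<open>T\<^sup>* z\<close> of \<open>y\<close> onto the range, and \<open>\<langle>x, T\<^sup>* z\<rangle> = \<langle>T x, z\<rangle>\<close> has modulus at most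
  \<open>\<parallel>z\<parallel>\<close>.\<close>

lemma EP_operator_bounded_below:
  fixes T :: "'a::chilbert_space \<Rightarrow> 'a"
  assumes "EP_operator T"
  obtains K where "K \<ge> 0" and "\<And>x. x \<in> range T \<Longrightarrow> norm x \<le> K * norm (T x)"
proof -
  have T: "bounded_clinear T" and r: "range T = range (cadjoint T)" and cl: "closed (range T)"
    using assms by (auto simp: EP_operator_def)
  note lin = bounded_clinear_linear[OF T]
  define F where "F = {x \<in> range T. norm (T x) \<le> 1}"
  have "\<exists>K. \<forall>x\<in>F. cmod (cinner x y) \<le> K" for y
  proof -
    obtain p where "p \<in> range T" and p: "\<And>m. m \<in> range T \<Longrightarrow> cinner (y - p) m = 0"
      using orthogonal_projection_exists[OF range_csubspace[OF T] cl, of y] by blast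
    then obtain z where z: "p = cadjoint T z"
      using r by auto
    have "cmod (cinner x y) \<le> norm z" if "x \<in> F" for x
    proof -
      have "cinner x (y - p) = 0"
        using p[of x] that cinner_commute[of x "y - p"] by (simp add: F_def)
      then have "cinner x y = cinner (T x) z"
        by (simp add: z cinner_cadjoint[OF T] cinner_diff_right)
      moreover have "norm (T x) * norm z \<le> 1 * norm z"
        using that by (intro mult_right_mono) (auto simp: F_def)
      ultimately show ?thesis
        using cinner_Cauchy_Schwarz[of "T x" z] by simp
    qed
    then show ?thesis
      by blast
  qed
  from weakly_bounded_imp_bounded[OF this] obtain K where K: "\<And>x. x \<in> F \<Longrightarrow> norm x \<le> K"
    by blast
  have "0 \<in> F"
    using linear_0[OF lin] by (auto simp: F_def image_iff)
  then have "K \<ge> 0"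
    using K[of 0] by simp
  moreover have "norm x \<le> K * norm (T x)" if x: "x \<in> range T" for x
  proof (cases "T x = 0")
    case True
    then have "cinner x x = 0"
      using EP_operator_kernel[OF assms] x by blast
    then show ?thesis
      using True by (simp add: cinner_eq_zero_iff)
  next
    case False
    have "(1 / norm (T x)) *\<^sub>R x \<in> range T"
      using x linear_scale[OF lin] by (auto simp: image_iff) metis
    then have "(1 / norm (T x)) *\<^sub>R x \<in> F"
      using False by (simp add: F_def linear_scale[OF lin])
    from K[OF this] show ?thesis
      using False by (simp add: field_simps)
  qed
  ultimately show thesis
    using that by blast
qed

text \<open>The witness \<open>X\<close> sends \<open>x\<close> to the unique \<open>y\<close> in the range for which \<open>T y\<close> is the orthogonal
  projection of \<open>x\<close> onto the range. Both \<open>T \<circ> X\<close> and \<open>X \<circ> T\<close> are then that projection, from which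
  the Penrose equations can be read off.\<close>

lemma EP_operator_mp_inverse:
  fixes T :: "'a::chilbert_space \<Rightarrow> 'a"
  assumes EP: "EP_operator T"
  shows "T \<circ> mp_inverse T \<circ> T = T" and "mp_inverse T \<circ> T \<circ> mp_inverse T = mp_inverse T"
    and "mp_inverse T \<circ> T = T \<circ> mp_inverse T"
proof -
  have T: "bounded_clinear T" and cl: "closed (range T)"
    using EP by (auto simp: EP_operator_def)
  note sub = range_csubspace[OF T]
  note ker = EP_operator_kernel[OF EP]
  obtain K where "K \<ge> 0" and K: "\<And>x. x \<in> range T \<Longrightarrow> norm x \<le> K * norm (T x)"
    using EP_operator_bounded_below[OF EP] by blast
  have "\<exists>p. p \<in> range T \<and> (\<forall>m\<in>range T. cinner (x - p) m = 0)" for x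
    using orthogonal_projection_exists[OF sub cl, of x] by blast
  then obtain P where PM: "\<And>x. P x \<in> range T"
    and "\<And>x. \<forall>m\<in>range T. cinner (x - P x) m = 0"
    by metis
  then have ker_P: "T (x - P x) = 0" for x
    by (simp only: ker)
  then have TP: "T (P x) = T x" for x
    using bounded_clinear_diff[OF T, of x "P x"] by simp
  have inj: "y = z" if "y \<in> range T" "z \<in> range T" "T y = T z" for y z
    using K[OF csubspace_diff[OF sub that(1,2)]] that(3) by (simp add: bounded_clinear_diff[OF T])
  have "\<exists>y. y \<in> range T \<and> T y = P x" for x
  proof -
    obtain w where "P x = T w"
      using PM[of x] by auto
    then show ?thesis
      using PM TP by metis
  qed
  then obtain X where XM: "\<And>x. X x \<in> range T" and TX: "\<And>x. T (X x) = P x"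
    by metis
  have P_eqI: "P x = p" if "p \<in> range T" "T p = T x" for x p
    by (rule inj) (simp_all add: that PM TP)
  have X_eqI: "X x = y" if "y \<in> range T" "T (T y) = T x" for x y
    using inj[OF XM that(1)] P_eqI[of "T y" x] that by (simp add: TX)
  have XT: "X (T x) = P x" for x
    by (rule X_eqI) (simp_all add: PM TP)
  have P_add: "P (x + y) = P x + P y" for x y
    by (intro P_eqI csubspace_add[OF sub] PM) (simp add: bounded_clinear_add[OF T] TP)
  have P_scaleC: "P (c *\<^sub>C x) = c *\<^sub>C P x" for c x
    by (intro P_eqI csubspace_scaleC[OF sub] PM) (simp add: bounded_clinear_scaleC[OF T] TP)
  have P_orth: "cinner (P x) (y - P y) = 0" for x y
  proof -
    have "cinner (y - P y) (P x) = 0"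
      using ker[of "y - P y"] ker_P[of y] PM[of x] by blast
    then show ?thesis
      using cinner_commute[of "P x" "y - P y"] by simp
  qed
  have P_norm: "norm (P x) \<le> norm x" for x
    by (rule power2_le_imp_le) (use norm_add_eq_if_orthogonal[OF P_orth, of x x] in simp_all)
  have "bounded_clinear P"
    by (rule bounded_clinearI[where K = 1]) (simp_all add: P_add P_scaleC P_norm)
  moreover have "cinner (P x) y = cinner x (P y)" for x y
  proof -
    have "cinner (x - P x) (P y) = 0"
      using P_orth[of y x] cinner_commute[of "x - P x" "P y"] by simp
    then show ?thesis
      using P_orth[of x y] by (simp add: cinner_diff_left cinner_diff_right)
  qed
  ultimately have P_adj: "cadjoint P = P"
    by (rule cadjoint_eqI)
  have X: "bounded_clinear X"
  proof (rule bounded_clinearI)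
    show "X (x + y) = X x + X y" for x y
      by (intro X_eqI csubspace_add[OF sub] XM) (simp add: bounded_clinear_add[OF T] TX TP)
    show "X (c *\<^sub>C x) = c *\<^sub>C X x" for c x
      by (intro X_eqI csubspace_scaleC[OF sub] XM) (simp add: bounded_clinear_scaleC[OF T] TX TP)
    show "norm (X x) \<le> norm x * K" for x
      using K[OF XM, of x] mult_left_mono[OF P_norm[of x] \<open>K \<ge> 0\<close>]
      by (simp add: TX mult.commute)
  qed
  have TX': "T \<circ> X = P" and XT': "X \<circ> T = P"
    by (simp_all add: fun_eq_iff TX XT)
  have TXT: "T \<circ> X \<circ> T = T" and XTX: "X \<circ> T \<circ> X = X"
    by (simp_all add: TX' XT' fun_eq_iff P_eqI XM)
  have "mp_inverse T = X"
    using T X TXT XTX by (rule mp_inverse_eqI) (simp_all add: TX' XT' P_adj)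
  then show "T \<circ> mp_inverse T \<circ> T = T" and "mp_inverse T \<circ> T \<circ> mp_inverse T = mp_inverse T"
    and "mp_inverse T \<circ> T = T \<circ> mp_inverse T"
    using TXT XTX TX' XT' by simp_all
qed

section \<open>Intertwining relations\<close>

text \<open>Both sides equal \<open>Y \<circ> B \<circ> T \<circ> X\<close>. On the left, \<open>A X = A T X X = S B X X\<close> lies in the range of
  \<open>S\<close>, on which \<open>Y S\<close> is the identity, so \<open>A X = Y S A X = Y B T X\<close>. On the right,
  \<open>Y B = Y Y S B = Y Y A T\<close> is unchanged on composing with \<open>T X\<close> from the right.\<close>

lemma intertwine_group_inverse:
  fixes T X :: "'a \<Rightarrow> 'a" and S Y :: "'b \<Rightarrow> 'b" and A B :: "'a \<Rightarrow> 'b"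
  assumes T: "T \<circ> X \<circ> T = T" "X \<circ> T \<circ> X = X" "X \<circ> T = T \<circ> X"
    and S: "S \<circ> Y \<circ> S = S" "Y \<circ> S \<circ> Y = Y" "Y \<circ> S = S \<circ> Y"
    and AT: "A \<circ> T = S \<circ> B" and BT: "B \<circ> T = S \<circ> A"
  shows "A \<circ> X = Y \<circ> B"
proof -
  have t: "T (X (T x)) = T x" "X (T (X x)) = X x" "X (T x) = T (X x)" for x
    using T by (simp_all add: fun_eq_iff)
  have s: "S (Y (S x)) = S x" "Y (S (Y x)) = Y x" "Y (S x) = S (Y x)" for x
    using S by (simp_all add: fun_eq_iff)
  have at: "A (T x) = S (B x)" and bt: "B (T x) = S (A x)" for x
    using AT BT by (simp_all add: fun_eq_iff)
  have "A (X x) = Y (B (T (X x)))" for x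
  proof -
    have "A (X x) = S (B (X (X x)))"
      by (metis t at)
    also have "\<dots> = S (Y (A (T (X (X x)))))"
      by (metis s at)
    also have "\<dots> = Y (S (A (X x)))"
      by (metis s t)
    finally show ?thesis
      by (simp add: bt)
  qed
  moreover have "Y (B x) = Y (B (T (X x)))" for x
  proof -
    have "Y (B x) = Y (Y (A (T x)))"
      by (metis s at)
    also have "\<dots> = Y (Y (A (T (T (X x)))))"
      by (metis t)
    also have "\<dots> = Y (Y (S (B (T (X x)))))"
      by (simp only: at)
    finally show ?thesis
      by (metis s)
  qed
  ultimately show ?thesis
    by (simp add: fun_eq_iff)
qed

theorem theorem3p21:
  fixes T S A B :: "'a::chilbert_space \<Rightarrow> 'a"
  assumes "EP_operator T" and "EP_operator S"
    and "bounded_clinear A" and "bounded_clinear B"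
    and "A \<circ> T = S \<circ> B" and "B \<circ> T = S \<circ> A"
  shows "A \<circ> mp_inverse T = mp_inverse S \<circ> B \<and> B \<circ> mp_inverse T = mp_inverse S \<circ> A"
proof -
  note group_inverses = EP_operator_mp_inverse[OF assms(1)] EP_operator_mp_inverse[OF assms(2)]
  show ?thesis
    using intertwine_group_inverse[OF group_inverses assms(5,6)]
      intertwine_group_inverse[OF group_inverses assms(6,5)]
    by blast
qed

end
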